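(* Let $G=(V,E,\mu,\omega)$ be a finite connected weighted graph and let $\Omega\subseteq V$ satisfy $\Omega^\circ\neq\emptyset$. Let $N=\#\Omega^\circ$ and let $\{\varphi_j\}_{j=1}^N$ be an orthonormal basis of $W_0^{1,2}(\Omega)$ consisting of eigenfunctions of $-\Delta$, with $-\Delta\varphi_j=\lambda_j\varphi_j$ for $j=1,\dots,N$. Then the solution of $$\begin{cases}\partial_t u+u=\Delta u, & (x,t)\in\Omega^\circ\times[0,\infty),\\ u(x,0)=h(x), & x\in\Omega^\circ,\\ u(x,t)=0, & (x,t)\in\partial\Omega\times[0,\infty),\end{cases}$$ where $h:\Omega^\circ\to\mathbb{R}$ is given, is $$u(x,t)=\sum_{j=1}^N h_j(0)\,e^{-(\lambda_j+1)t}\varphi_j(x),\qquad h_j(0)=(h,\varphi_j)_{W_0^{1,2}(\Omega)}.$$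
   Context: A finite connected weighted graph $G=(V,E,\mu,\omega)$ (without isolated points) consists of a finite connected graph $(V,E)$ ($x\sim y$ means $xy\in E$), a vertex measure $\mu:V\to(0,\infty)$ and an edge weight $\omega:E\to(0,\infty)$ with $\omega_{xy}=\omega_{yx}>0$. For nonempty $\Omega\subseteq V$, $\partial\Omega:=\{x\in\Omega:\text{ there is } y\in V\setminus\Omega \text{ with } y\sim x\}$ and $\Omega^\circ:=\Omega\setminus\partial\Omega$. $\Delta v(x)=\frac{1}{\mu(x)}\sum_{y\sim x}\omega_{xy}(v(y)-v(x))$ and $\Gamma(w,v)(x)=\frac{1}{2\mu(x)}\sum_{y\sim x}\omega_{xy}(w(y)-w(x))(v(y)-v(x))$; $\int_U v\,d\mu=\sum_{x\in U}\mu(x)v(x)$. $W_0^{1,2}(\Omega)$ is the completion of the space of functions $v:\Omega\to\mathbb{R}$ vanishing on $\partial\Omega$ (extended by $0$ to $V$ where needed) under the norm $\left(\int_\Omega(\Gamma(v,v)+v^2)\,d\mu\right)^{1/2}$; since $\Omega$ is finite it is just this space, and it is a Hilbert space with inner product $(w,v)_{W_0^{1,2}(\Omega)}=\int_\Omega(\Gamma(w,v)+wv)\,d\mu$. The eigenvalue equation $-\Delta\varphi_j=\lambda_j\varphi_j$ is understood on $\Omega^\circ$, with $\varphi_j=0$ on $\partial\Omega$; $h$ is regarded as an element of $W_0^{1,2}(\Omega)$ by setting $h=0$ on $\partial\Omega$. A solution is a function continuously differentiable in $t$ that satisfies all three lines of the problem. *)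

theory Defs
  imports "HOL-Analysis.Analysis" "Graph_Theory.Digraph_Component"
begin

text \<open>
  An undirected graph is a symmetric loop-free digraph: \<open>x \<sim> y\<close> is \<open>(x, y) \<in> parcs G\<close>.
  The edge weight is a function on pairs of vertices; only its values on edges are constrained,
  and only these are ever used.
\<close>

locale finite_weighted_graph = pair_graph G
  for G :: "'v pair_pre_digraph" +
  fixes \<mu> :: "'v \<Rightarrow> real" and \<omega> :: "'v \<Rightarrow> 'v \<Rightarrow> real"
  assumes graph_connected: "Digraph_Component.connected (with_proj G)"
    and no_isolated: "x \<in> pverts G \<Longrightarrow> \<exists>y. (x, y) \<in> parcs G"
    and vertex_measure_pos: "x \<in> pverts G \<Longrightarrow> \<mu> x > 0"
    and edge_weight_pos: "(x, y) \<in> parcs G \<Longrightarrow> \<omega> x y > 0"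
    and edge_weight_sym: "(x, y) \<in> parcs G \<Longrightarrow> \<omega> x y = \<omega> y x"

definition vbdry :: "'v pair_pre_digraph \<Rightarrow> 'v set \<Rightarrow> 'v set" where
  "vbdry G \<Omega> = {x \<in> \<Omega>. \<exists>y \<in> pverts G - \<Omega>. (x, y) \<in> parcs G}"

definition vinterior :: "'v pair_pre_digraph \<Rightarrow> 'v set \<Rightarrow> 'v set" where
  "vinterior G \<Omega> = \<Omega> - vbdry G \<Omega>"

definition laplacian ::
  "'v pair_pre_digraph \<Rightarrow> ('v \<Rightarrow> real) \<Rightarrow> ('v \<Rightarrow> 'v \<Rightarrow> real) \<Rightarrow> ('v \<Rightarrow> real) \<Rightarrow> 'v \<Rightarrow> real" where
  "laplacian G \<mu> \<omega> v x = 1 / \<mu> x * (\<Sum>y | (x, y) \<in> parcs G. \<omega> x y * (v y - v x))"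

definition grad_form ::
  "'v pair_pre_digraph \<Rightarrow> ('v \<Rightarrow> real) \<Rightarrow> ('v \<Rightarrow> 'v \<Rightarrow> real)
    \<Rightarrow> ('v \<Rightarrow> real) \<Rightarrow> ('v \<Rightarrow> real) \<Rightarrow> 'v \<Rightarrow> real" where
  "grad_form G \<mu> \<omega> w v x =
     1 / (2 * \<mu> x) * (\<Sum>y | (x, y) \<in> parcs G. \<omega> x y * (w y - w x) * (v y - v x))"

definition vertex_integral :: "('v \<Rightarrow> real) \<Rightarrow> 'v set \<Rightarrow> ('v \<Rightarrow> real) \<Rightarrow> real" where
  "vertex_integral \<mu> U v = (\<Sum>x\<in>U. \<mu> x * v x)"

text \<open>
  The space \<open>W\<^sub>0\<^sup>1\<^sup>,\<^sup>2(\<Omega>)\<close>. As \<open>\<Omega>\<close> is finite, no completion is needed. A function on \<open>\<Omega>\<close> vanishing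
  on the boundary is represented by its extension by zero to the whole vertex type, so that
  equality of functions is equality on \<open>\<Omega>\<close>.
\<close>

definition W0 :: "'v pair_pre_digraph \<Rightarrow> 'v set \<Rightarrow> ('v \<Rightarrow> real) set" where
  "W0 G \<Omega> = {v. (\<forall>x \<in> vbdry G \<Omega>. v x = 0) \<and> (\<forall>x. x \<notin> \<Omega> \<longrightarrow> v x = 0)}"

definition W0_inner ::
  "'v pair_pre_digraph \<Rightarrow> ('v \<Rightarrow> real) \<Rightarrow> ('v \<Rightarrow> 'v \<Rightarrow> real) \<Rightarrow> 'v set
    \<Rightarrow> ('v \<Rightarrow> real) \<Rightarrow> ('v \<Rightarrow> real) \<Rightarrow> real" where
  "W0_inner G \<mu> \<omega> \<Omega> w v =
     vertex_integral \<mu> \<Omega> (\<lambda>x. grad_form G \<mu> \<omega> w v x + w x * v x)"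

definition W0_orthonormal_basis ::
  "'v pair_pre_digraph \<Rightarrow> ('v \<Rightarrow> real) \<Rightarrow> ('v \<Rightarrow> 'v \<Rightarrow> real) \<Rightarrow> 'v set
    \<Rightarrow> 'i set \<Rightarrow> ('i \<Rightarrow> 'v \<Rightarrow> real) \<Rightarrow> bool" where
  "W0_orthonormal_basis G \<mu> \<omega> \<Omega> J \<phi> \<longleftrightarrow>
     finite J \<and>
     (\<forall>j\<in>J. \<phi> j \<in> W0 G \<Omega>) \<and>
     (\<forall>i\<in>J. \<forall>j\<in>J. W0_inner G \<mu> \<omega> \<Omega> (\<phi> i) (\<phi> j) = (if i = j then 1 else 0)) \<and>
     (\<forall>v\<in>W0 G \<Omega>. \<exists>c. v = (\<lambda>x. \<Sum>j\<in>J. c j * \<phi> j x))"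

definition dirichlet_eigenfunction ::
  "'v pair_pre_digraph \<Rightarrow> ('v \<Rightarrow> real) \<Rightarrow> ('v \<Rightarrow> 'v \<Rightarrow> real) \<Rightarrow> 'v set
    \<Rightarrow> real \<Rightarrow> ('v \<Rightarrow> real) \<Rightarrow> bool" where
  "dirichlet_eigenfunction G \<mu> \<omega> \<Omega> l f \<longleftrightarrow>
     f \<in> W0 G \<Omega> \<and> f \<noteq> (\<lambda>x. 0) \<and>
     (\<forall>x \<in> vinterior G \<Omega>. - laplacian G \<mu> \<omega> f x = l * f x)"

definition zero_extend :: "'v set \<Rightarrow> ('v \<Rightarrow> real) \<Rightarrow> 'v \<Rightarrow> real" where
  "zero_extend A h = (\<lambda>x. if x \<in> A then h x else 0)"

text \<open>
  Only the values of \<open>u\<close> on \<open>\<Omega> \<times> [0,\<infinity>)\<close> matter here: all neighbours of an interior point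
  lie in \<open>\<Omega>\<close>, and the time derivative at \<open>0\<close> is one-sided.
\<close>

definition heat_solution ::
  "'v pair_pre_digraph \<Rightarrow> ('v \<Rightarrow> real) \<Rightarrow> ('v \<Rightarrow> 'v \<Rightarrow> real) \<Rightarrow> 'v set
    \<Rightarrow> ('v \<Rightarrow> real) \<Rightarrow> ('v \<Rightarrow> real \<Rightarrow> real) \<Rightarrow> bool" where
  "heat_solution G \<mu> \<omega> \<Omega> h u \<longleftrightarrow>
     (\<exists>u'. (\<forall>x\<in>\<Omega>. (\<forall>t\<ge>0. (u x has_real_derivative u' x t) (at t within {0..})) \<and>
                   continuous_on {0..} (u' x)) \<and>
           (\<forall>x\<in>vinterior G \<Omega>. \<forall>t\<ge>0. u' x t + u x t = laplacian G \<mu> \<omega> (\<lambda>y. u y t) x)) \<and>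
     (\<forall>x\<in>vinterior G \<Omega>. u x 0 = h x) \<and>
     (\<forall>x\<in>vbdry G \<Omega>. \<forall>t\<ge>0. u x t = 0)"

end

theory Submission
  imports Defs
begin

text \<open>
  For a solution \<open>u\<close> the coefficients \<open>c\<^sub>j(t) = (u(t), \<phi>\<^sub>j)\<close> in the eigenbasis satisfy the decoupled
  equations \<open>c\<^sub>j' = -(\<lambda>\<^sub>j + 1) c\<^sub>j\<close>: the time derivative of \<open>u(t)\<close> lies again in \<open>W\<^sub>0\<^sup>1\<^sup>,\<^sup>2(\<Omega>)\<close> and
  equals \<open>- \<Sum>\<^sub>j (\<lambda>\<^sub>j + 1) c\<^sub>j(t) \<phi>\<^sub>j\<close> because \<open>\<Delta>\<close> acts diagonally on the basis. Hence \<open>c\<^sub>j\<close> is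
  \<open>c\<^sub>j(0)\<close> times an exponential.
\<close>

section \<open>Linearity in finite linear combinations\<close>

lemma laplacian_sum:
  "laplacian G \<mu> \<omega> (\<lambda>x. \<Sum>j\<in>J. c j * f j x) x = (\<Sum>j\<in>J. c j * laplacian G \<mu> \<omega> (f j) x)"
proof -
  have "(\<Sum>y | (x, y) \<in> parcs G. \<omega> x y * ((\<Sum>j\<in>J. c j * f j y) - (\<Sum>j\<in>J. c j * f j x)))
      = (\<Sum>y | (x, y) \<in> parcs G. \<Sum>j\<in>J. c j * (\<omega> x y * (f j y - f j x)))"
    unfolding sum_subtractf [symmetric] sum_distrib_left
    by (intro sum.cong refl) (simp add: algebra_simps)
  also have "\<dots> = (\<Sum>j\<in>J. c j * (\<Sum>y | (x, y) \<in> parcs G. \<omega> x y * (f j y - f j x)))"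
    by (subst sum.swap) (simp add: sum_distrib_left)
  finally show ?thesis
    unfolding laplacian_def by (simp add: sum_distrib_left mult.left_commute)
qed

lemma grad_form_sum_left:
  "grad_form G \<mu> \<omega> (\<lambda>x. \<Sum>j\<in>J. c j * f j x) v x = (\<Sum>j\<in>J. c j * grad_form G \<mu> \<omega> (f j) v x)"
proof -
  have "(\<Sum>y | (x, y) \<in> parcs G.
          \<omega> x y * ((\<Sum>j\<in>J. c j * f j y) - (\<Sum>j\<in>J. c j * f j x)) * (v y - v x))
      = (\<Sum>y | (x, y) \<in> parcs G. \<Sum>j\<in>J. c j * (\<omega> x y * (f j y - f j x) * (v y - v x)))"
    unfolding sum_subtractf [symmetric] sum_distrib_left sum_distrib_right
    by (intro sum.cong refl) (simp add: algebra_simps)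
  also have "\<dots> = (\<Sum>j\<in>J. c j * (\<Sum>y | (x, y) \<in> parcs G. \<omega> x y * (f j y - f j x) * (v y - v x)))"
    by (subst sum.swap) (simp add: sum_distrib_left)
  finally show ?thesis
    unfolding grad_form_def by (simp add: sum_distrib_left mult.left_commute)
qed

lemma W0_inner_sum_left:
  "W0_inner G \<mu> \<omega> \<Omega> (\<lambda>x. \<Sum>j\<in>J. c j * f j x) v = (\<Sum>j\<in>J. c j * W0_inner G \<mu> \<omega> \<Omega> (f j) v)"
proof -
  have "W0_inner G \<mu> \<omega> \<Omega> (\<lambda>x. \<Sum>j\<in>J. c j * f j x) v
      = (\<Sum>x\<in>\<Omega>. \<Sum>j\<in>J. c j * (\<mu> x * (grad_form G \<mu> \<omega> (f j) v x + f j x * v x)))"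
    unfolding W0_inner_def vertex_integral_def grad_form_sum_left
      sum_distrib_right sum.distrib [symmetric] sum_distrib_left
    by (intro sum.cong refl) (simp add: algebra_simps)
  also have "\<dots> = (\<Sum>j\<in>J. c j * W0_inner G \<mu> \<omega> \<Omega> (f j) v)"
    unfolding W0_inner_def vertex_integral_def by (subst sum.swap) (simp add: sum_distrib_left)
  finally show ?thesis .
qed

section \<open>Fourier expansion in an orthonormal basis\<close>

lemma W0_inner_sum_basis:
  assumes "W0_orthonormal_basis G \<mu> \<omega> \<Omega> J \<phi>" and "k \<in> J"
  shows "W0_inner G \<mu> \<omega> \<Omega> (\<lambda>x. \<Sum>j\<in>J. c j * \<phi> j x) (\<phi> k) = c k"
proof -
  have "(\<Sum>j\<in>J. c j * W0_inner G \<mu> \<omega> \<Omega> (\<phi> j) (\<phi> k)) = (\<Sum>j\<in>J. if j = k then c j else 0)"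
    using assms unfolding W0_orthonormal_basis_def by (intro sum.cong) auto
  then show ?thesis
    using assms unfolding W0_inner_sum_left W0_orthonormal_basis_def by simp
qed

text \<open>Spanning supplies some coefficients, and orthonormality identifies each of them as the
  inner product with the corresponding basis function.\<close>

lemma W0_basis_expansion:
  assumes B: "W0_orthonormal_basis G \<mu> \<omega> \<Omega> J \<phi>" and "v \<in> W0 G \<Omega>"
  shows "v = (\<lambda>x. \<Sum>j\<in>J. W0_inner G \<mu> \<omega> \<Omega> v (\<phi> j) * \<phi> j x)"
proof -
  obtain c where c: "v = (\<lambda>x. \<Sum>j\<in>J. c j * \<phi> j x)"
    using assms unfolding W0_orthonormal_basis_def by blast
  have "W0_inner G \<mu> \<omega> \<Omega> v (\<phi> j) = c j" if "j \<in> J" for j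
    unfolding c by (rule W0_inner_sum_basis [OF B that])
  then have "(\<Sum>j\<in>J. W0_inner G \<mu> \<omega> \<Omega> v (\<phi> j) * \<phi> j x) = v x" for x
    unfolding c by simp
  then show ?thesis by auto
qed

section \<open>Differentiation in time and the scalar linear equation\<close>

lemma grad_form_has_derivative_left:
  assumes w: "\<And>x. ((\<lambda>t. w t x) has_real_derivative w' x) (at t within S)"
  shows "((\<lambda>t. grad_form G \<mu> \<omega> (w t) v x) has_real_derivative grad_form G \<mu> \<omega> w' v x) (at t within S)"
  unfolding grad_form_def
  by (rule DERIV_cmult DERIV_sum DERIV_cmult_right DERIV_diff w)+

text \<open>The derivative is asked for at every \<open>x\<close>, not just in
  \<open>\<Omega>\<close>, because the gradient form at a boundary vertex reads values at neighbours
  outside \<open>\<Omega>\<close>.\<close>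

lemma W0_inner_has_derivative_left:
  assumes w: "\<And>x. ((\<lambda>t. w t x) has_real_derivative w' x) (at t within S)"
  shows "((\<lambda>t. W0_inner G \<mu> \<omega> \<Omega> (w t) v) has_real_derivative W0_inner G \<mu> \<omega> \<Omega> w' v) (at t within S)"
  unfolding W0_inner_def vertex_integral_def
  by (rule DERIV_sum DERIV_cmult DERIV_add grad_form_has_derivative_left DERIV_cmult_right w)+

text \<open>Integrating factor: \<open>f t * exp (- k * t)\<close> has zero derivative on the convex
  set \<open>{0..}\<close>, hence equals its value at \<open>0\<close>.\<close>

lemma linear_ode_unique:
  fixes f :: "real \<Rightarrow> real"
  assumes "\<And>t. t \<ge> 0 \<Longrightarrow> (f has_real_derivative k * f t) (at t within {0..})" and "t \<ge> 0"
  shows "f t = f 0 * exp (k * t)"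
proof -
  have "((\<lambda>t. f t * exp (- k * t)) has_real_derivative 0) (at s within {0..})" if "s \<in> {0..}" for s
    using that by (auto intro!: derivative_eq_intros assms(1))
  then obtain c where "\<forall>s\<in>{0..}. f s * exp (- k * s) = c"
    using has_field_derivative_zero_constant [OF convex_real_interval(1)] by blast
  with \<open>t \<ge> 0\<close> have "f t * exp (- k * t) = f 0"
    by force
  then show ?thesis
    by (auto simp: exp_minus field_simps)
qed

section \<open>The Laplacian at interior vertices\<close>

text \<open>All neighbours of an interior vertex lie in \<open>\<Omega>\<close>. This permits
  replacing a solution by its zero extension under the Laplacian.\<close>

lemma (in finite_weighted_graph) laplacian_cong:
  assumes "\<And>y. y \<in> \<Omega> \<Longrightarrow> f y = g y" and "\<Omega> \<subseteq> pverts G" and x: "x \<in> vinterior G \<Omega>"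
  shows "laplacian G \<mu> \<omega> f x = laplacian G \<mu> \<omega> g x"
proof -
  have "y \<in> \<Omega>" if "(x, y) \<in> parcs G" for y
    using that x in_arcsD2 [OF that]
    unfolding vinterior_def vbdry_def by auto
  moreover have "x \<in> \<Omega>"
    using x unfolding vinterior_def by auto
  ultimately show ?thesis
    unfolding laplacian_def using assms(1) by (auto intro!: sum.cong)
qed

lemma zero_extend_interior_in_W0: "zero_extend (vinterior G \<Omega>) h \<in> W0 G \<Omega>"
  unfolding zero_extend_def W0_def vinterior_def by auto

lemma laplacian_eigen_expansion:
  assumes "\<And>j. j \<in> J \<Longrightarrow> dirichlet_eigenfunction G \<mu> \<omega> \<Omega> (l j) (\<phi> j)" and "x \<in> vinterior G \<Omega>"
  shows "laplacian G \<mu> \<omega> (\<lambda>x. \<Sum>j\<in>J. c j * \<phi> j x) x = (\<Sum>j\<in>J. - l j * c j * \<phi> j x)"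
proof -
  have "laplacian G \<mu> \<omega> (\<phi> j) x = - l j * \<phi> j x" if "j \<in> J" for j
    using assms(1) [OF that] assms(2) unfolding dirichlet_eigenfunction_def by force
  then show ?thesis
    unfolding laplacian_sum by (auto intro!: sum.cong)
qed

section \<open>Uniqueness and existence for the heat problem\<close>

text \<open>Uniqueness: the data determine every coefficient. A solution is unconstrained off
  \<open>\<Omega>\<close>, so its zero extension is what enters the inner product.\<close>

lemma (in finite_weighted_graph) heat_solution_coefficient:
  assumes \<Omega>: "\<Omega> \<subseteq> pverts G"
    and B: "W0_orthonormal_basis G \<mu> \<omega> \<Omega> J \<phi>"
    and E: "\<And>j. j \<in> J \<Longrightarrow> dirichlet_eigenfunction G \<mu> \<omega> \<Omega> (l j) (\<phi> j)"
    and H: "heat_solution G \<mu> \<omega> \<Omega> h u"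
    and "k \<in> J" and "t \<ge> 0"
  shows "W0_inner G \<mu> \<omega> \<Omega> (zero_extend \<Omega> (\<lambda>x. u x t)) (\<phi> k)
       = W0_inner G \<mu> \<omega> \<Omega> (zero_extend (vinterior G \<Omega>) h) (\<phi> k) * exp (- (l k + 1) * t)"
proof -
  define v where "v t = zero_extend \<Omega> (\<lambda>x. u x t)" for t
  define c where "c t j = W0_inner G \<mu> \<omega> \<Omega> (v t) (\<phi> j)" for t j
  \<comment> \<open>Candidate for the time derivative of \<open>v\<close>, already expanded in the
    basis: \<open>- l j\<close> comes from the Laplacian and \<open>- 1\<close> from the term
    \<open>u\<close> of the equation.\<close>
  define v' where "v' t = (\<lambda>x. \<Sum>j\<in>J. - (l j + 1) * c t j * \<phi> j x)" for t
  obtain u' where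
    du: "\<And>x t. x \<in> \<Omega> \<Longrightarrow> t \<ge> 0 \<Longrightarrow> (u x has_real_derivative u' x t) (at t within {0..})" and
    eq: "\<And>x t. x \<in> vinterior G \<Omega> \<Longrightarrow> t \<ge> 0 \<Longrightarrow> u' x t + u x t = laplacian G \<mu> \<omega> (\<lambda>y. u y t) x"
    and init: "\<And>x. x \<in> vinterior G \<Omega> \<Longrightarrow> u x 0 = h x"
    and bdry: "\<And>x t. x \<in> vbdry G \<Omega> \<Longrightarrow> t \<ge> 0 \<Longrightarrow> u x t = 0"
    using H unfolding heat_solution_def by blast
  have vW: "v t \<in> W0 G \<Omega>" if "t \<ge> 0" for t
    using bdry that unfolding v_def W0_def zero_extend_def by auto
  have vexp: "v t = (\<lambda>x. \<Sum>j\<in>J. c t j * \<phi> j x)" if "t \<ge> 0" for t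
    unfolding c_def by (rule W0_basis_expansion [OF B vW [OF that]])
  have int: "u' x t = v' t x" if x: "x \<in> vinterior G \<Omega>" and t: "t \<ge> 0" for x t
  proof -
    have "laplacian G \<mu> \<omega> (\<lambda>y. u y t) x = laplacian G \<mu> \<omega> (v t) x"
      by (rule laplacian_cong [OF _ \<Omega> x]) (simp add: v_def zero_extend_def)
    also have "\<dots> = (\<Sum>j\<in>J. - l j * c t j * \<phi> j x)"
      unfolding vexp [OF t] by (rule laplacian_eigen_expansion [OF E x])
    finally have "u' x t = (\<Sum>j\<in>J. - l j * c t j * \<phi> j x) - v t x"
      using eq [OF x t] x unfolding v_def zero_extend_def vinterior_def by auto
    also have "\<dots> = v' t x"
      unfolding vexp [OF t] v'_def sum_subtractf [symmetric]
      by (intro sum.cong refl) (simp add: algebra_simps)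
    finally show ?thesis .
  qed
  \<comment> \<open>At interior vertices this is the equation. At all other vertices both
    \<open>v\<close> and \<open>v'\<close> vanish, by the boundary condition or the extension for
    \<open>v\<close>, and since each \<open>\<phi> j\<close> lies in \<open>W0\<close> for
    \<open>v'\<close>.\<close>
  have dv: "((\<lambda>t. v t x) has_real_derivative v' t x) (at t within {0..})" if t: "t \<ge> 0" for x t
  proof (cases "x \<in> vinterior G \<Omega>")
    case True
    then have x: "x \<in> \<Omega>" unfolding vinterior_def by simp
    show ?thesis
      using du [OF x t] x int [OF True t] unfolding v_def zero_extend_def by simp
  next
    case False
    have "v s x = 0" if "s \<ge> 0" for s
      using bdry [OF _ that] False unfolding v_def zero_extend_def vinterior_def by auto
    moreover have "\<phi> j x = 0" if "j \<in> J" for j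
      using E [OF that] False unfolding dirichlet_eigenfunction_def W0_def vinterior_def by blast
    ultimately show ?thesis
      using has_field_derivative_transform_within [of "\<lambda>_. 0" 0 t "{0..}" 1 "\<lambda>s. v s x"] t
      unfolding v'_def by simp
  qed
  \<comment> \<open>Pairing \<open>v'\<close> with \<open>\<phi> k\<close> singles out the
    \<open>k\<close>-th coefficient, which decouples the system.\<close>
  have "((\<lambda>s. c s k) has_real_derivative - (l k + 1) * c t k) (at t within {0..})" if "t \<ge> 0" for t
  proof -
    have "W0_inner G \<mu> \<omega> \<Omega> (v' t) (\<phi> k) = - (l k + 1) * c t k"
      unfolding v'_def by (rule W0_inner_sum_basis [OF B \<open>k \<in> J\<close>])
    moreover have "((\<lambda>s. c s k) has_real_derivative W0_inner G \<mu> \<omega> \<Omega> (v' t) (\<phi> k))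
        (at t within {0..})"
      unfolding c_def by (rule W0_inner_has_derivative_left [OF dv [OF that]])
    ultimately show ?thesis by (simp only:)
  qed
  then have "c t k = c 0 k * exp (- (l k + 1) * t)"
    using \<open>t \<ge> 0\<close> by (rule linear_ode_unique)
  \<comment> \<open>The initial condition covers only the interior; on the boundary the value
    \<open>0\<close> comes from the boundary condition at time \<open>0\<close>.\<close>
  moreover have "v 0 = zero_extend (vinterior G \<Omega>) h"
  proof
    show "v 0 x = zero_extend (vinterior G \<Omega>) h x" for x
      using init [of x] bdry [of x 0] unfolding v_def zero_extend_def vinterior_def by auto
  qed
  ultimately show ?thesis
    unfolding c_def v_def by simp
qed

text \<open>Existence: the sum is differentiated term by term, and the Laplacian multiplies its
  \<open>j\<close>-th term by \<open>- l j\<close>. Agreement of \<open>u\<close> with the sum on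
  \<open>\<Omega>\<close> and for \<open>t \<ge> 0\<close> suffices.\<close>

lemma (in finite_weighted_graph) heat_solution_eigen_sum:
  assumes \<Omega>: "\<Omega> \<subseteq> pverts G"
    and B: "W0_orthonormal_basis G \<mu> \<omega> \<Omega> J \<phi>"
    and E: "\<And>j. j \<in> J \<Longrightarrow> dirichlet_eigenfunction G \<mu> \<omega> \<Omega> (l j) (\<phi> j)"
    and a: "\<And>j. a j = W0_inner G \<mu> \<omega> \<Omega> (zero_extend (vinterior G \<Omega>) h) (\<phi> j)"
    and u: "\<And>x t. x \<in> \<Omega> \<Longrightarrow> t \<ge> 0 \<Longrightarrow> u x t = (\<Sum>j\<in>J. a j * exp (- (l j + 1) * t) * \<phi> j x)"
  shows "heat_solution G \<mu> \<omega> \<Omega> h u"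
proof -
  define u' where "u' x t = (\<Sum>j\<in>J. - (l j + 1) * (a j * exp (- (l j + 1) * t)) * \<phi> j x)" for x t
  have "(u x has_real_derivative u' x t) (at t within {0..})" if "x \<in> \<Omega>" "t \<ge> 0" for x t
  proof -
    have "((\<lambda>t. \<Sum>j\<in>J. a j * exp (- (l j + 1) * t) * \<phi> j x) has_real_derivative u' x t)
        (at t within {0..})"
      unfolding u'_def
      by (rule DERIV_sum) (auto intro!: derivative_eq_intros simp: algebra_simps)
    then show ?thesis
      \<comment> \<open>The derivative passes from the sum to \<open>u\<close> because it is taken
        within \<open>{0..}\<close>, where the two agree; the radius \<open>1\<close> is
        arbitrary.\<close>
      by (rule has_field_derivative_transform_within [where d = 1]) (use that u in auto)
  qed
  moreover have "continuous_on {0..} (u' x)" for x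
    unfolding u'_def by (intro continuous_intros)
  moreover have "u' x t + u x t = laplacian G \<mu> \<omega> (\<lambda>y. u y t) x"
    if x: "x \<in> vinterior G \<Omega>" and t: "t \<ge> 0" for x t
  proof -
    have "laplacian G \<mu> \<omega> (\<lambda>y. u y t) x
        = laplacian G \<mu> \<omega> (\<lambda>y. \<Sum>j\<in>J. a j * exp (- (l j + 1) * t) * \<phi> j y) x"
      by (rule laplacian_cong [OF _ \<Omega> x]) (rule u [OF _ t])
    also have "\<dots> = (\<Sum>j\<in>J. - l j * (a j * exp (- (l j + 1) * t)) * \<phi> j x)"
      by (rule laplacian_eigen_expansion [OF E x])
    also have "\<dots> = u' x t + u x t"
    proof -
      have "x \<in> \<Omega>" using x unfolding vinterior_def by simp
      then show ?thesis
        unfolding u'_def u [OF \<open>x \<in> \<Omega>\<close> t] sum.distrib [symmetric]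
        by (intro sum.cong refl) (simp add: algebra_simps)
    qed
    finally show ?thesis ..
  qed
  moreover have "u x 0 = h x" if "x \<in> vinterior G \<Omega>" for x
  proof -
    have "u x 0 = (\<Sum>j\<in>J. a j * \<phi> j x)"
      using u [of x 0] that unfolding vinterior_def by simp
    \<comment> \<open>At time \<open>0\<close> the exponentials are \<open>1\<close>, leaving the
      basis expansion of the extended initial datum.\<close>
    also have "\<dots> = zero_extend (vinterior G \<Omega>) h x"
      unfolding a by (rule fun_cong [OF W0_basis_expansion [OF B zero_extend_interior_in_W0], symmetric])
    finally show ?thesis using that unfolding zero_extend_def by simp
  qed
  moreover have "u x t = 0" if "x \<in> vbdry G \<Omega>" "t \<ge> 0" for x t
  proof -
    have "x \<in> \<Omega>" using that(1) unfolding vbdry_def by simp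
    moreover have "\<phi> j x = 0" if "j \<in> J" for j
      using E [OF that] \<open>x \<in> vbdry G \<Omega>\<close> unfolding dirichlet_eigenfunction_def W0_def by blast
    ultimately show ?thesis using u \<open>t \<ge> 0\<close> by simp
  qed
  ultimately show ?thesis
    unfolding heat_solution_def by blast
qed

text \<open>The equivalence expresses both that the formula solves the problem and that every
  solution is given by it on \<open>\<Omega>\<close> for \<open>t \<ge> 0\<close>; values elsewhere
  are left free.\<close>

theorem corollary1p3:
  fixes G :: "'v pair_pre_digraph"
    and \<mu> :: "'v \<Rightarrow> real" and \<omega> :: "'v \<Rightarrow> 'v \<Rightarrow> real"
    and \<Omega> :: "'v set" and N :: nat
    and \<phi> :: "nat \<Rightarrow> 'v \<Rightarrow> real" and lam :: "nat \<Rightarrow> real"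
    and h :: "'v \<Rightarrow> real"
  assumes "finite_weighted_graph G \<mu> \<omega>"
    and "\<Omega> \<subseteq> pverts G"
    and "vinterior G \<Omega> \<noteq> {}"
    and "N = card (vinterior G \<Omega>)"
    and "W0_orthonormal_basis G \<mu> \<omega> \<Omega> {1..N} \<phi>"
    and "\<forall>j\<in>{1..N}. dirichlet_eigenfunction G \<mu> \<omega> \<Omega> (lam j) (\<phi> j)"
  shows "\<forall>u. heat_solution G \<mu> \<omega> \<Omega> h u \<longleftrightarrow>
    (\<forall>x\<in>\<Omega>. \<forall>t\<ge>0. u x t =
       (\<Sum>j=1..N. W0_inner G \<mu> \<omega> \<Omega> (zero_extend (vinterior G \<Omega>) h) (\<phi> j)
                  * exp (- (lam j + 1) * t) * \<phi> j x))"
proof (intro allI iffI ballI impI)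
  interpret finite_weighted_graph G \<mu> \<omega> by (rule assms(1))
  note B = assms(5)
  have E: "\<And>j. j \<in> {1..N} \<Longrightarrow> dirichlet_eigenfunction G \<mu> \<omega> \<Omega> (lam j) (\<phi> j)"
    using assms(6) by blast
  let ?a = "\<lambda>j. W0_inner G \<mu> \<omega> \<Omega> (zero_extend (vinterior G \<Omega>) h) (\<phi> j)"
  fix u
  show "heat_solution G \<mu> \<omega> \<Omega> h u"
    if "\<forall>x\<in>\<Omega>. \<forall>t\<ge>0. u x t = (\<Sum>j=1..N. ?a j * exp (- (lam j + 1) * t) * \<phi> j x)"
    using heat_solution_eigen_sum [OF assms(2) B E, where a = ?a and u = u] that by blast
  fix x and t :: real
  assume H: "heat_solution G \<mu> \<omega> \<Omega> h u" and "x \<in> \<Omega>" and t: "t \<ge> 0"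
  \<comment> \<open>At a fixed time the extended solution lies in \<open>W0\<close>, so it is
    recovered from its coefficients, which are already known.\<close>
  let ?v = "zero_extend \<Omega> (\<lambda>x. u x t)"
  have "?v \<in> W0 G \<Omega>"
    using H t unfolding heat_solution_def W0_def zero_extend_def by auto
  then have "?v x = (\<Sum>j=1..N. W0_inner G \<mu> \<omega> \<Omega> ?v (\<phi> j) * \<phi> j x)"
    using W0_basis_expansion [OF B] by meson
  also have "\<dots> = (\<Sum>j=1..N. ?a j * exp (- (lam j + 1) * t) * \<phi> j x)"
    using heat_solution_coefficient [OF assms(2) B E H _ t] by (intro sum.cong) auto
  finally show "u x t = (\<Sum>j=1..N. ?a j * exp (- (lam j + 1) * t) * \<phi> j x)"
    using \<open>x \<in> \<Omega>\<close> unfolding zero_extend_def by simp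
qed

end
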